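(* Let $k\ge 2$ and $\pi\in S_k$. Let $\pi'\in S_{k-1}$ be the permutation obtained by removing the entry $1$ from $\pi$ (viewed as the sequence $\pi(1),\dots,\pi(k)$) and then normalizing the result. Then for every integer $n>1$, $$g(\pi,n) \le 30(\log_2 n)\cdot g(\pi',n).$$
   Context: For $\sigma\in S_m$, a $\sigma$-wave is an increasing sequence of integers $x_1<\cdots<x_{m+1}$ such that for all $1\le i,j\le m$, $x_{i+1}-x_i > x_{j+1}-x_j$ if and only if $\sigma(i)>\sigma(j)$. A set of integers is $\sigma$-wave-free if it contains no $\sigma$-wave, and $g(\sigma,n)$ is the largest cardinality of a $\sigma$-wave-free subset of $[n]=\{1,\dots,n\}$. The normalization of a sequence of distinct integers $y_1,\dots,y_m$ is the unique permutation $\tau\in S_m$ with $\tau(i)>\tau(j)$ iff $y_i>y_j$. *)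

theory Defs
  imports Complex_Main "HOL-Combinatorics.Permutations"
begin

text \<open>
  An element of $S_m$ is a function \<open>\<sigma>\<close> with \<open>\<sigma> permutes {1..m}\<close>. Such a function does not
  determine \<open>m\<close>, so \<open>m\<close> is an explicit argument below. Only the values \<open>x 1, \<dots>, x (m + 1)\<close>
  of a sequence \<open>x\<close> are relevant.
\<close>

definition wave :: "nat \<Rightarrow> (nat \<Rightarrow> nat) \<Rightarrow> (nat \<Rightarrow> int) \<Rightarrow> bool" where
  "wave m \<sigma> x \<longleftrightarrow>
     strict_mono_on {1..m + 1} x \<and>
     (\<forall>i\<in>{1..m}. \<forall>j\<in>{1..m}. x (i + 1) - x i > x (j + 1) - x j \<longleftrightarrow> \<sigma> i > \<sigma> j)"

definition wave_free :: "nat \<Rightarrow> (nat \<Rightarrow> nat) \<Rightarrow> int set \<Rightarrow> bool" where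
  "wave_free m \<sigma> A \<longleftrightarrow> \<not> (\<exists>x. wave m \<sigma> x \<and> x ` {1..m + 1} \<subseteq> A)"

definition g :: "nat \<Rightarrow> (nat \<Rightarrow> nat) \<Rightarrow> nat \<Rightarrow> nat" where
  "g m \<sigma> n = Max (card ` {A. A \<subseteq> {1..int n} \<and> wave_free m \<sigma> A})"

definition is_normalization :: "'a::linorder list \<Rightarrow> (nat \<Rightarrow> nat) \<Rightarrow> bool" where
  "is_normalization ys \<tau> \<longleftrightarrow>
     \<tau> permutes {1..length ys} \<and>
     (\<forall>i\<in>{1..length ys}. \<forall>j\<in>{1..length ys}. \<tau> i > \<tau> j \<longleftrightarrow> ys ! (i - 1) > ys ! (j - 1))"

definition normalization :: "'a::linorder list \<Rightarrow> nat \<Rightarrow> nat" where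
  "normalization ys = (THE \<tau>. is_normalization ys \<tau>)"

definition remove_one :: "nat \<Rightarrow> (nat \<Rightarrow> nat) \<Rightarrow> nat \<Rightarrow> nat" where
  "remove_one k \<pi> = normalization (removeAll 1 (map \<pi> [1..<k + 1]))"

text \<open>The maximum in \<^const>\<open>g\<close> and the description in \<^const>\<open>normalization\<close> are well-defined.\<close>

lemma g_set_finite: "finite (card ` {A. A \<subseteq> {1..int n} \<and> wave_free m \<sigma> A})"
  by simp

lemma g_set_nonempty: "card ` {A. A \<subseteq> {1..int n} \<and> wave_free m \<sigma> A} \<noteq> {}"
proof -
  have "wave_free m \<sigma> {}"
    by (auto simp: wave_free_def)
  then show ?thesis by blast
qed

lemma normalization_ex1:
  fixes ys :: "'a::linorder list"
  assumes "distinct ys"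
  shows "\<exists>!\<tau>. is_normalization ys \<tau>"
proof -
  define I where "I = {1..length ys}"
  define y where "y = (\<lambda>i. ys ! (i - 1))"
  define r where "r = (\<lambda>i. if i \<in> I then card {j \<in> I. y j \<le> y i} else i)"
  have finI: "finite I" by (simp add: I_def)
  have inj: "inj_on y I"
    using assms by (auto simp: inj_on_def I_def y_def nth_eq_iff_index_eq)
  have less: "r j < r i" if "i \<in> I" "j \<in> I" "y j < y i" for i j
  proof -
    have "{l \<in> I. y l \<le> y j} \<subset> {l \<in> I. y l \<le> y i}"
      using that by force
    then show ?thesis using that finI by (simp add: r_def psubset_card_mono)
  qed
  have iff: "r j < r i \<longleftrightarrow> y j < y i" if "i \<in> I" "j \<in> I" for i j
    using less[OF that] less[OF that(2,1)] inj that
    by (metis inj_onD linorder_neqE not_less_iff_gr_or_eq)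
  have rinj: "inj_on r I"
    using iff inj by (metis (no_types, lifting) inj_on_def less_irrefl linorder_neqE)
  have "r ` I \<subseteq> I"
  proof
    fix v assume "v \<in> r ` I"
    then obtain i where i: "i \<in> I" "v = card {j \<in> I. y j \<le> y i}" by (auto simp: r_def)
    have "card {j \<in> I. y j \<le> y i} \<le> card I" by (rule card_mono) (auto simp: finI)
    moreover have "card {j \<in> I. y j \<le> y i} > 0"
      using i finI by (auto simp: card_gt_0_iff)
    ultimately show "v \<in> I" using i by (simp add: I_def)
  qed
  then have "bij_betw r I I"
    using rinj finI by (simp add: bij_betw_def endo_inj_surj)
  then have "r permutes I"
    by (rule bij_imp_permutes) (simp add: r_def)
  then have ex: "is_normalization ys r"
    using iff by (simp add: is_normalization_def I_def y_def)
  have "\<tau> = r" if "is_normalization ys \<tau>" for \<tau>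
  proof
    fix i
    have p: "\<tau> permutes I" and o: "\<And>i j. i \<in> I \<Longrightarrow> j \<in> I \<Longrightarrow> \<tau> j < \<tau> i \<longleftrightarrow> y j < y i"
      using that by (auto simp: is_normalization_def I_def y_def)
    show "\<tau> i = r i"
    proof (cases "i \<in> I")
      case False
      then show ?thesis using p by (simp add: r_def permutes_not_in)
    next
      case True
      then have "\<tau> i \<in> I" using p by (simp add: permutes_in_image)
      have "\<tau> ` {j \<in> I. y j \<le> y i} = {1..\<tau> i}"
      proof (intro subset_antisym subsetI)
        fix v assume "v \<in> \<tau> ` {j \<in> I. y j \<le> y i}"
        then obtain j where "j \<in> I" "y j \<le> y i" "v = \<tau> j" by auto
        then show "v \<in> {1..\<tau> i}"
          using o[of j i] True permutes_in_image[OF p, of j] by (auto simp: I_def not_less[symmetric])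
      next
        fix v assume v: "v \<in> {1..\<tau> i}"
        then have "v \<in> I" using \<open>\<tau> i \<in> I\<close> by (auto simp: I_def)
        then obtain j where "j \<in> I" "v = \<tau> j" using permutes_image[OF p] by blast
        then show "v \<in> \<tau> ` {j \<in> I. y j \<le> y i}" using o[of j i] True v by force
      qed
      moreover have "card (\<tau> ` {j \<in> I. y j \<le> y i}) = card {j \<in> I. y j \<le> y i}"
        using p by (intro card_image inj_on_subset[OF permutes_inj_on[OF p]]) auto
      ultimately show ?thesis using True by (simp add: r_def)
    qed
  qed
  with ex show ?thesis by blast
qed

end

theory Submission
  imports Defs
begin

text \<open>
  Let \<open>A\<close> be \<open>\<pi>\<close>-wave-free and sort its elements by the dyadic scale \<open>h = 2 ^ j\<close> of the gap to their
  successor in \<open>A\<close>. Elements of one scale are \<open>h\<close>-separated; splitting them further by the residue of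
  \<open>c div h\<close> modulo 5 makes \<open>c \<mapsto> (c div h) div 5\<close> injective and preserves the order of differences
  with so much room that a \<open>\<pi>'\<close>-wave in the image lifts to points of \<open>A\<close> between which a successor
  can be inserted at the position of the entry 1, giving a \<open>\<pi>\<close>-wave. So each of the five classes has
  at most \<open>g \<pi>' n\<close> elements, and there are at most \<open>log 2 n + 1\<close> scales.
\<close>

section \<open>Elementary bounds on \<open>g\<close>\<close>

lemma card_le_g:
  assumes "A \<subseteq> {1..int n}" "wave_free m \<sigma> A"
  shows "card A \<le> g m \<sigma> n"
  unfolding g_def using assms by (intro Max_ge g_set_finite) auto

lemma g_attained:
  obtains A where "A \<subseteq> {1..int n}" "wave_free m \<sigma> A" "card A = g m \<sigma> n"
  using Max_in[OF g_set_finite[of n m \<sigma>] g_set_nonempty[of n m \<sigma>]]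
  unfolding g_def by (auto simp: image_iff)

lemma wave_free_singleton:
  assumes "m \<ge> 1"
  shows "wave_free m \<sigma> {a}"
  unfolding wave_free_def
proof
  assume "\<exists>x. wave m \<sigma> x \<and> x ` {1..m + 1} \<subseteq> {a}"
  then obtain x where x: "strict_mono_on {1..m + 1} x" "x ` {1..m + 1} \<subseteq> {a}"
    by (auto simp: wave_def)
  have "x 1 < x 2"
    using assms by (intro strict_mono_onD[OF x(1)]) auto
  moreover have "x 1 = a" "x 2 = a"
    using x(2) assms by (auto simp: image_subset_iff)
  ultimately show False by simp
qed

lemma g_pos:
  assumes "m \<ge> 1" "n \<ge> 1"
  shows "g m \<sigma> n \<ge> 1"
  using card_le_g[OF _ wave_free_singleton[OF assms(1), of \<sigma> 1], of n] assms(2) by simp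

section \<open>Removing the entry 1 and reinserting it as a gap\<close>

lemma strict_mono_on_atLeastAtMost_Suc:
  fixes x :: "nat \<Rightarrow> 'a::order"
  assumes "\<And>i. i \<in> {1..m} \<Longrightarrow> x i < x (i + 1)"
  shows "strict_mono_on {1..m + 1} x"
proof (rule strict_mono_onI)
  fix r s assume "r \<in> {1..m + 1}" "s \<in> {1..m + 1}" "r < s"
  from this(3,1,2) show "x r < x s"
  proof (induction s rule: less_Suc_induct)
    case (1 i)
    then show ?case using assms[of i] by auto
  next
    case (2 i j k)
    then show ?case by (force intro: less_trans)
  qed
qed

text \<open>Since \<open>\<pi>\<close> is injective, only position \<open>p\<close> carries the
  value 1, so removal shifts exactly the positions after \<open>p\<close> by one, and normalization
  keeps the order. The conditionals recover the original position in \<open>\<pi>\<close> of an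
  entry of the shortened list.\<close>

lemma remove_one_less_iff:
  assumes "\<pi> permutes {1..k}" "p \<in> {1..k}" "\<pi> p = 1" "i \<in> {1..k - 1}" "j \<in> {1..k - 1}"
  shows "remove_one k \<pi> i > remove_one k \<pi> j \<longleftrightarrow>
    \<pi> (if i < p then i else i + 1) > \<pi> (if j < p then j else j + 1)"
proof -
  define ys where "ys = removeAll 1 (map \<pi> [1..<k + 1])"
  have inj: "inj \<pi>" using assms(1) by (rule permutes_inj)
  have split: "[1..<k + 1] = [1..<p] @ p # [p + 1..<k + 1]"
    using assms(2) upt_add_eq_append[of 1 p "k + 1 - p"] upt_conv_Cons[of p "k + 1"] by (simp del: upt_Suc)
  have unaffected: "removeAll 1 (map \<pi> ls) = map \<pi> ls" if "p \<notin> set ls" for ls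
  proof (rule removeAll_id)
    show "1 \<notin> set (map \<pi> ls)"
      using that inj_image_mem_iff[OF inj, of p "set ls"] assms(3) by simp
  qed
  have ys: "ys = map \<pi> ([1..<p] @ [p + 1..<k + 1])"
    unfolding ys_def split map_append list.map removeAll_append removeAll.simps assms(3)
    by (simp add: unaffected del: upt_Suc One_nat_def)
  have "distinct ys"
    unfolding ys_def using inj_on_subset[OF inj subset_UNIV]
    by (intro distinct_removeAll) (simp add: distinct_map del: upt_Suc)
  then have "is_normalization ys (remove_one k \<pi>)"
    unfolding remove_one_def normalization_def ys_def[symmetric]
    by (rule theI'[OF normalization_ex1])
  moreover have "length ys = k - 1"
    unfolding ys using assms(2) by auto
  moreover have "ys ! (l - 1) = \<pi> (if l < p then l else l + 1)" if "l \<in> {1..k - 1}" for l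
    unfolding ys using that assms(2) by (auto simp: nth_append simp del: upt_Suc)
  ultimately show ?thesis
    using assms(4,5) unfolding is_normalization_def by auto
qed

text \<open>
  The scaled differences \<open>5 * h * (q (i + 1) - q i)\<close> of a \<open>\<pi>'\<close>-wave are \<open>5 * h\<close> apart. Of this, the
  two rounding errors consume less than \<open>2 * h\<close> and shortening one gap by \<open>e\<close> less than \<open>2 * h\<close>.
\<close>

lemma wave_insert:
  fixes y q :: "nat \<Rightarrow> int" and h e :: int
  assumes perm: "\<pi> permutes {1..k}" and p: "p \<in> {1..k}" "\<pi> p = 1"
    and wave: "wave (k - 1) (remove_one k \<pi>) q"
    and close: "\<And>i. i \<in> {1..k - 1} \<Longrightarrow> \<bar>y (i + 1) - y i - 5 * h * (q (i + 1) - q i)\<bar> < h"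
    and e: "0 < e" "e < 2 * h"
  shows "wave k \<pi> (\<lambda>i. if i \<le> p then y i else if i = p + 1 then y p + e else y (i - 1))"
    (is "wave k \<pi> ?z")
proof -
  define D where "D i = ?z (i + 1) - ?z i" for i
  \<comment> \<open>Inverse of the index shift in \<open>remove_one_less_iff\<close>: gap
    \<open>i\<close> of the new sequence, \<open>i \<noteq> p\<close>, comes from gap
    \<open>s i\<close> of \<open>q\<close>; gap \<open>p\<close> is \<open>e\<close> itself.\<close>
  define s where "s i = (if i < p then i else i - 1)" for i
  define d where "d i = q (s i + 1) - q (s i)" for i
  have s: "s i \<in> {1..k - 1}" "(if s i < p then s i else s i + 1) = i"
    if "i \<in> {1..k}" "i \<noteq> p" for i
    using that p by (auto simp: s_def)
  have Dp: "D p = e" by (simp add: D_def)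
  \<comment> \<open>Rounding costs less than \<open>h\<close> either way. The lower bound gives up
    \<open>2 * h\<close> more because gap \<open>p + 1\<close> starts at \<open>y p + e\<close> and
    so loses \<open>e\<close>.\<close>
  have bounds: "5 * h * d i - 3 * h < D i" "D i < 5 * h * d i + h"
    if "i \<in> {1..k}" "i \<noteq> p" for i
    using close[OF s(1)[OF that]] that p e
    by (auto simp: D_def d_def s_def abs_less_iff split: if_splits)
  have h: "h > 0" using e by simp
  have d_less: "d i < d j \<longleftrightarrow> \<pi> i < \<pi> j"
    if "i \<in> {1..k}" "i \<noteq> p" "j \<in> {1..k}" "j \<noteq> p" for i j
    using wave s[OF that(1,2)] s[OF that(3,4)] remove_one_less_iff[OF perm p, of "s j" "s i"]
    by (auto simp: wave_def d_def)
  have d_pos: "d i \<ge> 1" if "i \<in> {1..k}" "i \<noteq> p" for i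
  proof -
    have "strict_mono_on {1..k - 1 + 1} q" using wave by (simp add: wave_def)
    then have "q (s i) < q (s i + 1)"
      by (rule strict_mono_onD) (use s(1)[OF that] in auto)
    then show ?thesis by (simp add: d_def)
  qed
  have D_large: "D i > e" if "i \<in> {1..k}" "i \<noteq> p" for i
  proof -
    \<comment> \<open>For \<open>d i = 1\<close> the lower bound is
      \<open>5 * h - 3 * h = 2 * h\<close>, just enough to exceed \<open>e\<close>. This is what
      dictates the factor 5.\<close>
    have "5 * h * 1 \<le> 5 * h * d i" using d_pos[OF that] h by (intro mult_left_mono) auto
    then show ?thesis using bounds(1)[OF that] e by linarith
  qed
  have pos: "D i > 0" if "i \<in> {1..k}" for i
    using D_large[OF that] Dp e by (cases "i = p") auto
  have mono: "D i < D j" if "i \<in> {1..k}" "j \<in> {1..k}" "\<pi> i < \<pi> j" for i j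
  proof -
    have "\<pi> i \<ge> 1" using permutes_in_image[OF perm, of i] that(1) by simp
    then have jp: "j \<noteq> p" using that p by auto
    show ?thesis
    proof (cases "i = p")
      case True
      then show ?thesis using D_large that jp Dp by simp
    next
      case False
      then have "d i + 1 \<le> d j" using d_less[of i j] that jp by simp
      then have "5 * h * (d i + 1) \<le> 5 * h * d j" using h by (intro mult_left_mono) auto
      then have "5 * h * d i + 5 * h \<le> 5 * h * d j" by (simp add: algebra_simps)
      then show ?thesis using bounds[of i] bounds[of j] that jp False h by linarith
    qed
  qed
  have "D j < D i \<longleftrightarrow> \<pi> j < \<pi> i" if "i \<in> {1..k}" "j \<in> {1..k}" for i j
    using mono[OF that] mono[OF that(2,1)] injD[OF permutes_inj[OF perm], of i j]
    by (metis less_asym linorder_neqE_nat less_irrefl)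
  moreover have "strict_mono_on {1..k + 1} ?z"
    by (rule strict_mono_on_atLeastAtMost_Suc) (use pos in \<open>force simp: D_def\<close>)
  ultimately show ?thesis unfolding wave_def D_def by blast
qed

section \<open>Bounding one dyadic scale\<close>

text \<open>Rounding \<open>C\<close> gives a set free of waves for the reduced permutation: such a
  wave lifts to \<open>C\<close>, and inserting a point of \<open>A\<close> makes it a
  \<open>\<pi>\<close>-wave in \<open>A\<close>. The inserted point may lie outside
  \<open>C\<close>, hence the two sets.\<close>

lemma card_residue_class_le_g:
  fixes h r :: int
  assumes perm: "\<pi> permutes {1..k}" and k: "k \<ge> 2" and h: "h > 0"
    and free: "wave_free k \<pi> A" and C: "C \<subseteq> A" "C \<subseteq> {1..int n}"
    and sep: "\<And>c c'. c \<in> C \<Longrightarrow> c' \<in> C \<Longrightarrow> c < c' \<Longrightarrow> h \<le> c' - c"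
    and nxt: "\<And>c. c \<in> C \<Longrightarrow> \<exists>e. 0 < e \<and> e < 2 * h \<and> c + e \<in> A"
    and r: "\<And>c. c \<in> C \<Longrightarrow> (c div h) mod 5 = r"
  shows "card C \<le> g (k - 1) (remove_one k \<pi>) n"
proof -
  \<comment> \<open>The summand 1 keeps the image inside \<open>{1..int n}\<close> when
    \<open>c div h < 5\<close>.\<close>
  define f where "f c = (c div h) div 5 + 1" for c
  define t where "t c = c mod h" for c
  \<comment> \<open>The term \<open>h * (r - 5)\<close> is common to the whole class, so differences
    in \<open>C\<close> are \<open>5 * h\<close> times differences of \<open>f\<close> up to an
    error below \<open>h\<close>.\<close>
  have c_eq: "c = 5 * h * f c + h * (r - 5) + t c" if "c \<in> C" for c
  proof -
    have "c = h * (c div h) + t c" by (simp add: t_def)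
    moreover have "c div h = 5 * (f c - 1) + r"
      using r[OF that] by (simp add: f_def flip: r[OF that])
    ultimately show ?thesis by (simp add: algebra_simps)
  qed
  have t: "0 \<le> t c" "t c < h" for c using h by (auto simp: t_def)
  have inj: "inj_on f C"
  proof (rule linorder_inj_onI')
    fix c c' assume "c \<in> C" "c' \<in> C" "c < c'"
    \<comment> \<open>Equal values of \<open>f\<close> would leave only the remainders, so
      \<open>c' - c < h\<close>, against \<open>sep\<close>.\<close>
    then show "f c \<noteq> f c'"
      using sep[of c c'] c_eq[of c] c_eq[of c'] t[of c] t[of c'] by auto
  qed
  have "f ` C \<subseteq> {1..int n}"
  proof
    fix v assume "v \<in> f ` C"
    then obtain c where c: "c \<in> C" "v = f c" by auto
    then have cn: "1 \<le> c" "c \<le> int n" using C by auto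
    have "c div h \<le> c" "0 \<le> c div h"
      using cn h zdiv_mono2[of c 1 h] by (auto simp: pos_imp_zdiv_nonneg_iff)
    then show "v \<in> {1..int n}" using cn c by (auto simp: f_def)
  qed
  moreover have "wave_free (k - 1) (remove_one k \<pi>) (f ` C)"
    unfolding wave_free_def
  proof
    assume "\<exists>x. wave (k - 1) (remove_one k \<pi>) x \<and> x ` {1..k - 1 + 1} \<subseteq> f ` C"
    then obtain q where q: "wave (k - 1) (remove_one k \<pi>) q" "q ` {1..k} \<subseteq> f ` C"
      using k by auto
    define y where "y i = inv_into C f (q i)" for i
    have y: "y i \<in> C" "f (y i) = q i" if "i \<in> {1..k}" for i
      using q(2) that by (auto simp: y_def inv_into_into f_inv_into_f image_subset_iff)
    have "1 \<in> \<pi> ` {1..k}"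
      using permutes_image[OF perm] k by auto
    then obtain p where p: "p \<in> {1..k}" "\<pi> p = 1" by auto
    obtain e where e: "0 < e" "e < 2 * h" "y p + e \<in> A" using nxt[OF y(1)[OF p(1)]] by auto
    have "\<bar>y (i + 1) - y i - 5 * h * (q (i + 1) - q i)\<bar> < h" if "i \<in> {1..k - 1}" for i
    proof -
      have i: "i \<in> {1..k}" "i + 1 \<in> {1..k}" using that by auto
      show ?thesis
        using c_eq[OF y(1)[OF i(1)]] c_eq[OF y(1)[OF i(2)]] t[of "y i"] t[of "y (i + 1)"]
          y(2)[OF i(1)] y(2)[OF i(2)]
        by (simp add: right_diff_distrib)
    qed
    from wave_insert[OF perm p q(1) this e(1,2)]
    have "wave k \<pi> (\<lambda>i. if i \<le> p then y i else if i = p + 1 then y p + e else y (i - 1))" .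
    moreover have "(\<lambda>i. if i \<le> p then y i else if i = p + 1 then y p + e else y (i - 1)) ` {1..k + 1} \<subseteq> A"
    proof (rule image_subsetI)
      fix i assume "i \<in> {1..k + 1}"
      then have "i \<le> p \<Longrightarrow> i \<in> {1..k}" "p + 1 < i \<Longrightarrow> i - 1 \<in> {1..k}"
        using p(1) unfolding atLeastAtMost_iff by linarith+
      then have "i \<le> p \<Longrightarrow> y i \<in> A" "p + 1 < i \<Longrightarrow> y (i - 1) \<in> A"
        using y(1) C(1) by blast+
      then show "(if i \<le> p then y i else if i = p + 1 then y p + e else y (i - 1)) \<in> A"
        using e(3) by auto
    qed
    ultimately show False using free unfolding wave_free_def by blast
  qed
  ultimately have "card (f ` C) \<le> g (k - 1) (remove_one k \<pi>) n"
    by (rule card_le_g)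
  then show ?thesis using inj by (simp add: card_image)
qed

lemma card_scale_le_g:
  fixes h :: int
  assumes perm: "\<pi> permutes {1..k}" and k: "k \<ge> 2" and h: "h > 0"
    and free: "wave_free k \<pi> A" and C: "C \<subseteq> A" "C \<subseteq> {1..int n}"
    and sep: "\<And>c c'. c \<in> C \<Longrightarrow> c' \<in> C \<Longrightarrow> c < c' \<Longrightarrow> h \<le> c' - c"
    and nxt: "\<And>c. c \<in> C \<Longrightarrow> \<exists>e. 0 < e \<and> e < 2 * h \<and> c + e \<in> A"
  shows "card C \<le> 5 * g (k - 1) (remove_one k \<pi>) n"
proof -
  have "C = (\<Union>r\<in>{0..<5::int}. {c \<in> C. (c div h) mod 5 = r})" by auto
  then have "card C \<le> (\<Sum>r\<in>{0..<5::int}. card {c \<in> C. (c div h) mod 5 = r})"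
    by (metis card_UN_le finite_atLeastLessThan_int)
  also have "\<dots> \<le> (\<Sum>r\<in>{0..<5::int}. g (k - 1) (remove_one k \<pi>) n)"
    by (intro sum_mono card_residue_class_le_g[OF perm k h free]) (use C sep nxt in auto)
  finally show ?thesis by simp
qed

section \<open>Dyadic scales and the final bound\<close>

text \<open>The leading 1 accounts for \<open>Max A\<close>, which has no successor. Every other gap
  is between 1 and \<open>n\<close>, so its scale \<open>j\<close> satisfies
  \<open>0 \<le> j \<le> log 2 n\<close>.\<close>

lemma card_wave_free_le:
  assumes perm: "\<pi> permutes {1..k}" and k: "k \<ge> 2"
    and free: "wave_free k \<pi> A" and A: "A \<subseteq> {1..int n}"
  shows "card A \<le> 1 + (nat \<lfloor>log 2 n\<rfloor> + 1) * (5 * g (k - 1) (remove_one k \<pi>) n)"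
proof -
  define J where "J = nat \<lfloor>log 2 n\<rfloor> + 1"
  \<comment> \<open>At \<open>c = Max A\<close> this takes the minimum of an empty set, an
    unspecified value; hence \<open>C\<close> excludes that point.\<close>
  define gap where "gap c = Min {a \<in> A. c < a} - c" for c
  define C where "C j = {c \<in> A - {Max A}. 2 ^ j \<le> gap c \<and> gap c < 2 * 2 ^ j}" for j
  have fin: "finite A" using A by (rule finite_subset) simp
  have gap_le: "gap c \<le> c' - c" if "c' \<in> A" "c < c'" for c c'
    using that fin by (auto simp: gap_def)
  have gap: "gap c > 0" "c + gap c \<in> A" if "c \<in> A - {Max A}" for c
  proof -
    have "c < Max A" "Max A \<in> A" using that fin by (auto simp: order.strict_iff_order intro: Max_in)
    then have "Min {a \<in> A. c < a} \<in> {a \<in> A. c < a}" using fin by (intro Min_in) auto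
    then show "gap c > 0" "c + gap c \<in> A" by (auto simp: gap_def)
  qed
  have "A \<subseteq> insert (Max A) (\<Union>j<J. C j)"
  proof
    fix c assume c: "c \<in> A"
    show "c \<in> insert (Max A) (\<Union>j<J. C j)"
    proof (cases "c = Max A")
      case False
      with c gap have gc: "gap c > 0" "c + gap c \<in> A" by auto
      then have "gap c \<le> int n" using subsetD[OF A gc(2)] subsetD[OF A c] by simp
      have "1 \<le> nat (gap c)" using gc(1) by linarith
      from ex_power_ivl1[OF order_refl this]
      obtain j where j: "2 ^ j \<le> nat (gap c)" "nat (gap c) < 2 ^ (j + 1)" by blast
      have j': "2 ^ j \<le> gap c" "gap c < 2 * 2 ^ j"
        using j gc by (simp_all add: le_nat_iff nat_less_iff)
      have "real (2 ^ j) \<le> real n"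
        using j(1) \<open>gap c \<le> int n\<close> by (intro of_nat_mono) linarith
      then have "real j \<le> log 2 n" by (intro le_log2_of_power) simp
      then have "j < J" by (simp add: J_def le_nat_floor less_Suc_eq_le)
      then show ?thesis using c False j' by (auto simp: C_def)
    qed simp
  qed
  moreover have finC: "finite (\<Union>j<J. C j)" using fin by (auto simp: C_def)
  ultimately have "card A \<le> card (insert (Max A) (\<Union>j<J. C j))" by (intro card_mono) auto
  also have "\<dots> \<le> 1 + card (\<Union>j<J. C j)" using finC by (simp add: card_insert_if)
  also have "card (\<Union>j<J. C j) \<le> (\<Sum>j<J. card (C j))" by (rule card_UN_le) simp
  also have "\<dots> \<le> (\<Sum>j<J. 5 * g (k - 1) (remove_one k \<pi>) n)"
  proof (intro sum_mono card_scale_le_g[OF perm k _ free])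
    fix j c c' assume "c \<in> C j" "c' \<in> C j" "c < c'"
    \<comment> \<open>The successor of \<open>c\<close> is its nearest later element, so
      \<open>c'\<close> is at least \<open>gap c\<close> away.\<close>
    then show "2 ^ j \<le> c' - c" using gap_le[of c' c] by (auto simp: C_def)
  next
    fix j c assume "c \<in> C j"
    then show "\<exists>e. 0 < e \<and> e < 2 * 2 ^ j \<and> c + e \<in> A"
      using gap[of c] by (intro exI[of _ "gap c"]) (auto simp: C_def)
  qed (use A in \<open>auto simp: C_def\<close>)
  finally show ?thesis by (simp add: J_def)
qed

theorem theorem1p7:
  fixes k n :: nat and \<pi> :: "nat \<Rightarrow> nat"
  assumes "k \<ge> 2" and "\<pi> permutes {1..k}" and "n > 1"
  shows "real (g k \<pi> n) \<le> 30 * log 2 (real n) * real (g (k - 1) (remove_one k \<pi>) n)"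
proof -
  define G where "G = g (k - 1) (remove_one k \<pi>) n"
  define L where "L = log 2 (real n)"
  obtain A where A: "A \<subseteq> {1..int n}" "wave_free k \<pi> A" "card A = g k \<pi> n"
    by (rule g_attained)
  have L: "L \<ge> 1" using assms(3) by (simp add: L_def)
  have G: "real G \<ge> 1" using g_pos[of "k - 1" n] assms by (simp add: G_def)
  have "real (g k \<pi> n) \<le> real (1 + (nat \<lfloor>L\<rfloor> + 1) * (5 * G))"
    using card_wave_free_le[OF assms(2,1) A(2,1)] unfolding A(3) G_def L_def by (rule of_nat_mono)
  also have "\<dots> = 1 + (real (nat \<lfloor>L\<rfloor>) + 1) * (5 * real G)" by (simp add: algebra_simps)
  \<comment> \<open>As \<open>L\<close> and \<open>G\<close> are at least 1, the lone 1 is absorbed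
    by \<open>L * G\<close> and the 1 next to the floor by a second \<open>L\<close>. The total is
    \<open>11 * L * G\<close>.\<close>
  also have "\<dots> \<le> L * real G + (L + L) * (5 * real G)"
    using L G mult_mono[OF L G] by (intro add_mono mult_right_mono) linarith+
  also have "\<dots> \<le> 30 * L * real G" using L G by simp
  finally show ?thesis by (simp add: L_def G_def)
qed

end
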